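(* Let $k$ be a field of characteristic zero. There exist non-unimodal level $h$-vectors of codimension 3; that is, there exists a level algebra $A=k[x_1,x_2,x_3]/I$ of codimension 3 whose $h$-vector is not unimodal.
   Context: A standard graded artinian algebra is $A=R/I$, where $R=k[x_1,\dots,x_r]$ with all $x_i$ of degree 1 and $I$ is a homogeneous ideal of $R$ containing no non-zero forms of degree at most 1, such that $\dim_k A<\infty$. The $h$-vector of $A$ is $(h_0,h_1,\dots,h_e)$, where $h_i=\dim_k A_i$ and $e$ is the last index with $\dim_k A_e>0$; $e$ is the socle degree of $A$. The codimension of $A$ is $r=h_1$. The socle of $A$ is $\mathrm{soc}(A)=\{a\in A : a\,\overline{m}=0\}$, where $\overline{m}=(\overline{x_1},\dots,\overline{x_r})\subseteq A$; it is a homogeneous ideal. $A$ is level if $\mathrm{soc}(A)_i=0$ for all $i<e$ (equivalently $\mathrm{soc}(A)=A_e$). A level $h$-vector is the $h$-vector of some level algebra. An $h$-vector is unimodal if it never increases again once it has started to decrease, i.e. there are no indices $i<j$ with $h_i>h_{i+1}$ and $h_j<h_{j+1}$. *)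

theory Defs
  imports
    "HOL-Library.Poly_Mapping"
    "HOL-Library.Numeral_Type"
    "HOL-Algebra.Embedded_Algebras"
    "HOL-Algebra.QuotRing"
    "HOL-Algebra.Algebraic_Closure_Type"
begin

text \<open>
  The polynomial ring \<open>R = k[x\<^sub>v : v \<in> 'v]\<close> over a finite type \<open>'v\<close> of variables: a monomial is
  its exponent function \<open>'v \<Rightarrow>\<^sub>0 nat\<close>, and a polynomial maps monomials to coefficients.
  Multiplication on \<^typ>\<open>('v \<Rightarrow>\<^sub>0 nat) \<Rightarrow>\<^sub>0 'k\<close> is convolution, i.e. polynomial multiplication.
\<close>

type_synonym ('v, 'k) mpoly = "('v \<Rightarrow>\<^sub>0 nat) \<Rightarrow>\<^sub>0 'k"

abbreviation poly_ring :: "('v::finite, 'k::field) mpoly ring" where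
  "poly_ring \<equiv> ring_of_type_algebra"

definition const :: "'k::field \<Rightarrow> ('v::finite, 'k) mpoly" where
  "const c = Poly_Mapping.single 0 c"

definition var :: "'v::finite \<Rightarrow> ('v, 'k::field) mpoly" where
  "var v = Poly_Mapping.single (Poly_Mapping.single v 1) 1"

definition mon_degree :: "('v::finite \<Rightarrow>\<^sub>0 nat) \<Rightarrow> nat" where
  "mon_degree m = (\<Sum>v\<in>UNIV. Poly_Mapping.lookup m v)"

text \<open>The homogeneous component \<open>R\<^sub>d\<close>; it contains \<open>0\<close>.\<close>

definition forms :: "nat \<Rightarrow> ('v::finite, 'k::field) mpoly set" where
  "forms d = {f. \<forall>m \<in> Poly_Mapping.keys f. mon_degree m = d}"

definition homogeneous_ideal :: "('v::finite, 'k::field) mpoly set \<Rightarrow> bool" where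
  "homogeneous_ideal I \<longleftrightarrow> (\<exists>S. S \<subseteq> (\<Union>d. forms d) \<and> I = genideal poly_ring S)"

text \<open>\<open>A = R/I\<close>; its elements are cosets of \<open>I\<close>.\<close>

definition quot_alg :: "('v::finite, 'k::field) mpoly set \<Rightarrow> ('v, 'k) mpoly set ring" where
  "quot_alg I = poly_ring Quot I"

definition residue_class ::
  "('v::finite, 'k::field) mpoly set \<Rightarrow> ('v, 'k) mpoly \<Rightarrow> ('v, 'k) mpoly set" where
  "residue_class I f = I +>\<^bsub>poly_ring\<^esub> f"

text \<open>
  The copy of \<open>k\<close> in \<open>A\<close>, a subfield of \<open>A\<close> whenever \<open>I\<close> is a proper ideal. Dimensions over \<open>k\<close>
  are the dimensions over this subfield.
\<close>

definition scalars :: "('v::finite, 'k::field) mpoly set \<Rightarrow> ('v, 'k) mpoly set set" where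
  "scalars I = residue_class I ` range const"

definition graded_part ::
  "('v::finite, 'k::field) mpoly set \<Rightarrow> nat \<Rightarrow> ('v, 'k) mpoly set set" where
  "graded_part I i = residue_class I ` forms i"

definition standard_graded_artinian :: "('v::finite, 'k::field) mpoly set \<Rightarrow> bool" where
  "standard_graded_artinian I \<longleftrightarrow>
     homogeneous_ideal I \<and>
     (\<forall>d\<le>1. \<forall>f \<in> I \<inter> forms d. f = 0) \<and>
     ring.finite_dimension (quot_alg I) (scalars I) (carrier (quot_alg I))"

definition hilbert :: "('v::finite, 'k::field) mpoly set \<Rightarrow> nat \<Rightarrow> nat" where
  "hilbert I i = ring.dim (quot_alg I) (scalars I) (graded_part I i)"

definition socle_degree :: "('v::finite, 'k::field) mpoly set \<Rightarrow> nat" where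
  "socle_degree I = (GREATEST i. hilbert I i > 0)"

definition h_vector :: "('v::finite, 'k::field) mpoly set \<Rightarrow> nat list" where
  "h_vector I = map (hilbert I) [0..<Suc (socle_degree I)]"

definition codimension :: "('v::finite, 'k::field) mpoly set \<Rightarrow> nat" where
  "codimension I = hilbert I 1"

definition max_ideal :: "('v::finite, 'k::field) mpoly set \<Rightarrow> ('v, 'k) mpoly set set" where
  "max_ideal I = genideal (quot_alg I) (residue_class I ` range var)"

definition socle :: "('v::finite, 'k::field) mpoly set \<Rightarrow> ('v, 'k) mpoly set set" where
  "socle I = {a \<in> carrier (quot_alg I).
     \<forall>m \<in> max_ideal I. a \<otimes>\<^bsub>quot_alg I\<^esub> m = \<zero>\<^bsub>quot_alg I\<^esub>}"

definition level :: "('v::finite, 'k::field) mpoly set \<Rightarrow> bool" where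
  "level I \<longleftrightarrow> standard_graded_artinian I \<and>
     (\<forall>i < socle_degree I. socle I \<inter> graded_part I i = {\<zero>\<^bsub>quot_alg I\<^esub>})"

definition unimodal :: "nat list \<Rightarrow> bool" where
  "unimodal h \<longleftrightarrow> \<not> (\<exists>i j. i < j \<and> Suc j < length h \<and> h ! i > h ! Suc i \<and> h ! j < h ! Suc j)"

end

theory Submission
  imports Defs
begin

text \<open>
  The example is the monomial ideal \<open>I = x\<^sup>3(x\<^sup>4, y\<^sup>4, z\<^sup>4) + (x, y, z)\<^sup>1\<^sup>3\<close>. In degree \<open>i \<le> 12\<close> its
  \<open>h\<close>-vector is that of \<open>k[x,y,z]/(x\<^sup>3)\<close>, which grows by 3 at each step, plus the \<open>h\<close>-vector
  1, 3, 6, 10, 12, 12, 10, 6, 3, 1 of the complete intersection \<open>k[x,y,z]/(x\<^sup>4, y\<^sup>4, z\<^sup>4)\<close> shifted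
  by 3. The latter drops by 4 from degree 6 to degree 7 but only by 2 at its end, so that the sum
  has the entries 37, 36, 36, 37 in degrees 9 to 12. The algebra is level because every monomial
  of degree less than 12 outside \<open>I\<close> divides one of degree 12 outside \<open>I\<close>.
\<close>

section \<open>Quotients by monomial ideals\<close>

lemma poly_ring_simps [simp]:
  "carrier poly_ring = UNIV" "f \<otimes>\<^bsub>poly_ring\<^esub> g = f * g" "f \<oplus>\<^bsub>poly_ring\<^esub> g = f + g"
  "\<one>\<^bsub>poly_ring\<^esub> = 1" "\<zero>\<^bsub>poly_ring\<^esub> = 0"
  by (simp_all add: ring_of_type_algebra_def)

lemma cring_poly_ring: "cring (poly_ring :: ('v::finite, 'k::field) mpoly ring)"
  by (rule cring_from_type_algebra)

lemma ring_poly_ring: "ring (poly_ring :: ('v::finite, 'k::field) mpoly ring)"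
  by (rule ring_from_type_algebra)

lemma a_inv_poly_ring [simp]:
  "\<ominus>\<^bsub>poly_ring\<^esub> f = - (f :: ('v::finite, 'k::field) mpoly)"
proof -
  interpret R: ring "poly_ring :: ('v, 'k) mpoly ring" by (rule ring_poly_ring)
  show ?thesis by (rule R.minus_equality) simp_all
qed

lemma poly_mapping_sum_single:
  "f = (\<Sum>m\<in>Poly_Mapping.keys f. Poly_Mapping.single m (Poly_Mapping.lookup f m))"
proof (rule poly_mapping_eqI)
  fix k
  show "Poly_Mapping.lookup f k =
    Poly_Mapping.lookup (\<Sum>m\<in>Poly_Mapping.keys f. Poly_Mapping.single m (Poly_Mapping.lookup f m)) k"
    by (simp add: lookup_sum lookup_single when_def in_keys_iff)
qed

text \<open>By cancellation, multiplying by a monomial shifts exponents injectively, so no two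
  coefficients merge. The socle computation applies this to a variable.\<close>

lemma lookup_mult_single_add:
  fixes f :: "'a::cancel_comm_monoid_add \<Rightarrow>\<^sub>0 'b::comm_semiring_1"
  shows "Poly_Mapping.lookup (f * Poly_Mapping.single n 1) (m + n) = Poly_Mapping.lookup f m"
proof -
  have "f * Poly_Mapping.single n 1 =
    (\<Sum>l\<in>Poly_Mapping.keys f. Poly_Mapping.single (l + n) (Poly_Mapping.lookup f l))"
    by (subst poly_mapping_sum_single [of f]) (simp add: sum_distrib_right mult_single)
  then show ?thesis
    by (simp add: lookup_sum lookup_single when_def in_keys_iff)
qed

text \<open>The image of \<open>range const\<close> in the quotient is \<open>scalars I\<close>;
  dimensions over it are unique only once it is known to be a subfield.\<close>

lemma subfield_range_const:
  "subfield (range const) (poly_ring :: ('v::finite, 'k::field) mpoly ring)"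
proof -
  interpret R: cring "poly_ring :: ('v, 'k) mpoly ring" by (rule cring_poly_ring)
  have one: "1 = (const 1 :: ('v, 'k) mpoly)"
    by (simp add: const_def)
  have mult: "const a * const b = (const (a * b) :: ('v, 'k) mpoly)" for a b
    by (simp add: const_def mult_single)
  have inj: "const a = (const b :: ('v, 'k) mpoly) \<longleftrightarrow> a = b" for a b
    by (metis const_def lookup_single_eq)
  have zero: "0 = (const 0 :: ('v, 'k) mpoly)"
    by (simp add: const_def)
  show ?thesis
  proof (rule R.subfieldI)
    show "subcring (range const) (poly_ring :: ('v, 'k) mpoly ring)"
    proof (rule R.subcringI')
      show "subring (range const) (poly_ring :: ('v, 'k) mpoly ring)"
      proof (rule R.subringI)
        show "\<one>\<^bsub>poly_ring\<^esub> \<in> (range const :: ('v, 'k) mpoly set)"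
          by (simp add: one)
      qed (auto simp: const_def mult_single single_add [symmetric] single_uminus [symmetric])
    qed
    have "const a \<in> Units (poly_ring\<lparr>carrier := range const :: ('v, 'k) mpoly set\<rparr>) \<longleftrightarrow> a \<noteq> 0" for a
    proof
      assume "const a \<in> Units (poly_ring\<lparr>carrier := range const :: ('v, 'k) mpoly set\<rparr>)"
      then obtain b where "const (b * a) = (const 1 :: ('v, 'k) mpoly)"
        by (auto simp: Units_def one mult)
      then show "a \<noteq> 0"
        by (auto simp: inj)
    next
      assume "a \<noteq> 0"
      then have "const (inverse a) * const a = (1 :: ('v, 'k) mpoly)"
        "const a * const (inverse a) = (1 :: ('v, 'k) mpoly)"
        by (simp_all add: one mult)
      then show "const a \<in> Units (poly_ring\<lparr>carrier := range const :: ('v, 'k) mpoly set\<rparr>)"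
        by (auto simp: Units_def)
    qed
    moreover have "Units (poly_ring\<lparr>carrier := range const :: ('v, 'k) mpoly set\<rparr>) \<subseteq> range const"
      by (auto simp: Units_def)
    ultimately show "Units (poly_ring\<lparr>carrier := range const :: ('v, 'k) mpoly set\<rparr>) =
        range const - {\<zero>\<^bsub>poly_ring\<^esub>}"
      by (auto simp: zero inj)
  qed
qed

text \<open>\<open>N\<close> is the set of standard monomials, closed under divisors, and
  \<open>I\<close> is the span of all other monomials. Describing \<open>I\<close> by its complement
  turns membership into a condition on coefficients.\<close>

locale monomial_quotient =
  fixes N :: "('v::finite \<Rightarrow>\<^sub>0 nat) set" and I :: "('v, 'k::field) mpoly set"
  assumes finite_N: "finite N"
    and zero_in_N: "0 \<in> N"
    and divisor_in_N: "m + n \<in> N \<Longrightarrow> m \<in> N"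
    and I_def: "I = {f. Poly_Mapping.keys f \<inter> N = {}}"
begin

lemma in_I_iff: "f \<in> I \<longleftrightarrow> (\<forall>m\<in>N. Poly_Mapping.lookup f m = 0)"
  by (auto simp: I_def in_keys_iff disjoint_iff)

text \<open>Every monomial of \<open>f * g\<close> is a multiple of one of \<open>f\<close>; if it
  were in \<open>N\<close>, so would be its divisor.\<close>

lemma mult_in_I:
  assumes "f \<in> I"
  shows "f * g \<in> I"
proof -
  have "Poly_Mapping.keys (f * g) \<subseteq> {m + n |m n. m \<in> Poly_Mapping.keys f}"
    using keys_mult [of f g] by blast
  then show ?thesis
    using assms divisor_in_N unfolding I_def by blast
qed

sublocale R: cring "poly_ring :: ('v, 'k) mpoly ring"
  by (rule cring_poly_ring)

sublocale I: ideal I poly_ring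
proof (rule idealI)
  show "ring (poly_ring :: ('v, 'k) mpoly ring)"
    by (rule ring_poly_ring)
  have "I \<noteq> {}"
    by (rule ex_in_conv [THEN iffD1], rule exI [of _ 0]) (simp add: in_I_iff)
  then show "subgroup I (add_monoid poly_ring)"
    \<comment> \<open>Folding \<open>a_inv_def\<close> turns the inverse of the additive monoid into
      the ring negation, which \<open>a_inv_poly_ring\<close> evaluates.\<close>
    by (intro R.add.subgroupI) (auto simp: in_I_iff lookup_add a_inv_def [symmetric])
  show "f \<otimes>\<^bsub>poly_ring\<^esub> g \<in> I" "g \<otimes>\<^bsub>poly_ring\<^esub> f \<in> I" if "f \<in> I" for f g
    using mult_in_I [OF that, of g] by (simp_all add: mult.commute)
qed

sublocale Q: ring "quot_alg I"
  unfolding quot_alg_def by (rule I.quotient_is_ring)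

sublocale H: ring_hom_ring poly_ring "quot_alg I" "residue_class I"
proof -
  have "residue_class I = (+>\<^bsub>poly_ring\<^esub>) I"
    by (rule ext) (simp add: residue_class_def)
  then show "ring_hom_ring poly_ring (quot_alg I) (residue_class I)"
    using I.rcos_ring_hom_ring by (simp add: quot_alg_def)
qed

text \<open>A class is determined by its coefficients on \<open>N\<close>; this is what makes the
  monomials in \<open>N\<close> a basis of the quotient.\<close>

lemma residue_class_eq_iff:
  "residue_class I f = residue_class I g \<longleftrightarrow>
     (\<forall>m\<in>N. Poly_Mapping.lookup f m = Poly_Mapping.lookup g m)"
  using R.quotient_eq_iff_same_a_r_cos [OF I.is_ideal, of f g]
  by (simp add: residue_class_def a_minus_def in_I_iff lookup_minus)

lemma residue_class_eq_zero_iff: "residue_class I f = \<zero>\<^bsub>quot_alg I\<^esub> \<longleftrightarrow> f \<in> I"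
  using residue_class_eq_iff [of f 0] H.hom_zero by (simp add: in_I_iff)

lemma carrier_quot_alg: "carrier (quot_alg I) = range (residue_class I)"
  unfolding quot_alg_def FactRing_def A_RCOSETS_def RCOSETS_def residue_class_def a_r_coset_def by auto

lemma subfield_scalars: "subfield (scalars I) (quot_alg I)"
proof -
  \<comment> \<open>The quotient must be nontrivial for the image of a field to be a field.\<close>
  have "(1 :: ('v, 'k) mpoly) \<notin> I"
    using zero_in_N by (auto simp: in_I_iff lookup_one intro!: bexI [of _ 0])
  then have "\<one>\<^bsub>quot_alg I\<^esub> \<noteq> \<zero>\<^bsub>quot_alg I\<^esub>"
    using residue_class_eq_zero_iff [of 1] H.hom_one by simp
  then show ?thesis
    unfolding scalars_def using H.img_is_subfield(2) subfield_range_const by blast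
qed

section \<open>Monomial bases and the Hilbert function\<close>

definition monomial_span :: "('v \<Rightarrow>\<^sub>0 nat) set \<Rightarrow> ('v, 'k) mpoly set set" where
  "monomial_span M = residue_class I ` {f. Poly_Mapping.keys f \<subseteq> M}"

lemma monomial_span_Int: "monomial_span (M \<inter> N) = monomial_span M"
proof (intro equalityI subsetI)
  fix a assume "a \<in> monomial_span M"
  then obtain f where f: "a = residue_class I f" "Poly_Mapping.keys f \<subseteq> M"
    by (auto simp: monomial_span_def)
  \<comment> \<open>The truncation of \<open>f\<close> to \<open>N\<close> has the same class, since
    monomials outside \<open>N\<close> vanish in the quotient.\<close>
  define g where "g = (\<Sum>m\<in>Poly_Mapping.keys f \<inter> N. Poly_Mapping.single m (Poly_Mapping.lookup f m))"
  have g: "Poly_Mapping.lookup g k = (if k \<in> N then Poly_Mapping.lookup f k else 0)" for k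
    by (simp add: g_def lookup_sum lookup_single when_def in_keys_iff)
  have "residue_class I f = residue_class I g"
    by (simp add: residue_class_eq_iff g)
  moreover have "Poly_Mapping.keys g \<subseteq> M \<inter> N"
    using f(2) by (auto simp: in_keys_iff g subset_iff split: if_splits)
  ultimately show "a \<in> monomial_span (M \<inter> N)"
    by (auto simp: monomial_span_def f(1))
qed (auto simp: monomial_span_def)

text \<open>This brings the span into the shape of \<open>Q.Suc_dim\<close>, which builds dimensions
  by line extensions; the term at \<open>m\<close> is split off from the rest.\<close>

lemma monomial_span_insert:
  "monomial_span (insert m M) =
     Q.line_extension (scalars I) (residue_class I (Poly_Mapping.single m 1)) (monomial_span M)"
proof (intro equalityI subsetI)
  fix a assume "a \<in> monomial_span (insert m M)"
  then obtain f where f: "a = residue_class I f" "Poly_Mapping.keys f \<subseteq> insert m M"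
    by (auto simp: monomial_span_def)
  define g where "g = f - Poly_Mapping.single m (Poly_Mapping.lookup f m)"
  have "Poly_Mapping.keys g \<subseteq> M"
    using f(2) by (auto simp: g_def in_keys_iff lookup_minus lookup_single when_def subset_iff
        split: if_splits)
  moreover have "f = const (Poly_Mapping.lookup f m) * Poly_Mapping.single m 1 + g"
    by (simp add: g_def const_def mult_single)
  then have "a = residue_class I (const (Poly_Mapping.lookup f m)) \<otimes>\<^bsub>quot_alg I\<^esub>
      residue_class I (Poly_Mapping.single m 1) \<oplus>\<^bsub>quot_alg I\<^esub> residue_class I g"
    using f(1) H.hom_mult H.hom_add by (metis UNIV_I poly_ring_simps(1-3))
  ultimately show "a \<in> Q.line_extension (scalars I) (residue_class I (Poly_Mapping.single m 1))
      (monomial_span M)"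
    unfolding Q.line_extension_mem_iff scalars_def monomial_span_def by blast
next
  fix a assume "a \<in> Q.line_extension (scalars I) (residue_class I (Poly_Mapping.single m 1))
      (monomial_span M)"
  then obtain c g where a: "a = residue_class I (const c) \<otimes>\<^bsub>quot_alg I\<^esub>
      residue_class I (Poly_Mapping.single m 1) \<oplus>\<^bsub>quot_alg I\<^esub> residue_class I g"
    and g: "Poly_Mapping.keys g \<subseteq> M"
    unfolding Q.line_extension_mem_iff scalars_def monomial_span_def by blast
  define f where "f = const c * Poly_Mapping.single m 1 + g"
  have "a = residue_class I f"
    unfolding a f_def using H.hom_mult H.hom_add by (metis UNIV_I poly_ring_simps(1-3))
  moreover have "Poly_Mapping.keys f \<subseteq> insert m M"
    using g by (auto simp: f_def const_def mult_single in_keys_iff lookup_add lookup_single when_def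
        subset_iff split: if_splits)
  ultimately show "a \<in> monomial_span (insert m M)"
    by (auto simp: monomial_span_def)
qed

lemma dimension_monomial_span:
  assumes "M \<subseteq> N"
  shows "Q.dimension (card M) (scalars I) (monomial_span M)"
  using finite_subset [OF assms finite_N] assms
proof (induction M rule: finite_induct)
  case empty
  have "monomial_span {} = {\<zero>\<^bsub>quot_alg I\<^esub>}"
    using H.hom_zero by (simp add: monomial_span_def)
  then show ?case
    using Q.zero_dim by simp
next
  case (insert m M)
  have "residue_class I (Poly_Mapping.single m 1) \<notin> monomial_span M"
  proof
    assume "residue_class I (Poly_Mapping.single m 1) \<in> monomial_span M"
    then obtain f where "Poly_Mapping.keys f \<subseteq> M"
      "residue_class I (Poly_Mapping.single m 1) = residue_class I f"
      by (auto simp: monomial_span_def)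
    \<comment> \<open>Since \<open>m\<close> lies in \<open>N\<close>, its coefficient can be read
      off the residue class.\<close>
    then have "Poly_Mapping.lookup f m = 1" "Poly_Mapping.keys f \<subseteq> M"
      using insert.prems by (auto simp: residue_class_eq_iff)
    then show False
      using insert.hyps by (auto simp: in_keys_iff subset_iff)
  qed
  then show ?case
    using insert Q.Suc_dim by (simp add: monomial_span_insert carrier_quot_alg)
qed

lemma graded_part_eq: "graded_part I i = monomial_span {m. mon_degree m = i}"
  by (auto simp: graded_part_def monomial_span_def forms_def subset_iff)

lemma hilbert_eq: "hilbert I i = card {m \<in> N. mon_degree m = i}"
proof -
  have "{m. mon_degree m = i} \<inter> N = {m \<in> N. mon_degree m = i}"
    by blast
  then have "Q.dimension (card {m \<in> N. mon_degree m = i}) (scalars I) (graded_part I i)"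
    using dimension_monomial_span [of "{m \<in> N. mon_degree m = i}"]
      monomial_span_Int [of "{m. mon_degree m = i}"]
    by (simp add: graded_part_eq)
  then show ?thesis
    using Q.dimI [OF subfield_scalars] by (simp add: hilbert_def over_def)
qed

lemma finite_dimension_quot_alg: "Q.finite_dimension (scalars I) (carrier (quot_alg I))"
proof (rule Q.finite_dimensionI)
  show "Q.dimension (card N) (scalars I) (carrier (quot_alg I))"
    using dimension_monomial_span [of N] monomial_span_Int [of UNIV]
    by (simp add: carrier_quot_alg monomial_span_def)
qed

section \<open>Homogeneity, low degrees and the socle\<close>

lemma homogeneous_ideal: "homogeneous_ideal I"
proof -
  \<comment> \<open>All monomials outside \<open>N\<close> serve as homogeneous generators; no
    finite generating set is sought.\<close>
  define S :: "('v, 'k) mpoly set" where "S = (\<lambda>m. Poly_Mapping.single m 1) ` (- N)"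
  define J where "J = genideal poly_ring S"
  have S: "S \<subseteq> I"
    by (auto simp: S_def in_I_iff lookup_single when_def)
  interpret J: ideal J poly_ring
    unfolding J_def by (rule R.genideal_ideal) simp
  have "J \<subseteq> I"
    unfolding J_def by (rule R.genideal_minimal [OF I.is_ideal S])
  moreover have "f \<in> J" if "f \<in> I" for f
  proof -
    have single_J: "Poly_Mapping.single m c \<in> J" if "m \<notin> N" for m c
    proof -
      have "Poly_Mapping.single m 1 \<in> J"
        using R.genideal_self [of S] that unfolding J_def by (auto simp: S_def)
      then have "const c * Poly_Mapping.single m 1 \<in> J"
        using J.I_l_closed [of "Poly_Mapping.single m 1" "const c"] by simp
      then show ?thesis
        by (simp add: const_def mult_single)
    qed
    have sum_J: "sum g M \<in> J" if "\<And>m. m \<in> M \<Longrightarrow> g m \<in> J"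
      for M :: "('v \<Rightarrow>\<^sub>0 nat) set" and g
      using that
    proof (induction M rule: infinite_finite_induct)
      case (insert m M)
      then show ?case
        using J.a_closed [of "g m" "sum g M"] by simp
    qed (use J.zero_closed in simp_all)
    have "m \<notin> N" if "m \<in> Poly_Mapping.keys f" for m
      using that \<open>f \<in> I\<close> unfolding I_def by blast
    then have "(\<Sum>m\<in>Poly_Mapping.keys f. Poly_Mapping.single m (Poly_Mapping.lookup f m)) \<in> J"
      by (intro sum_J single_J)
    then show ?thesis
      by (simp only: poly_mapping_sum_single [symmetric])
  qed
  moreover have "S \<subseteq> (\<Union>d. forms d)"
    by (auto simp: S_def forms_def)
  ultimately show ?thesis
    unfolding homogeneous_ideal_def J_def by blast
qed

lemma standard_graded_artinian:
  assumes "\<And>m. mon_degree m \<le> 1 \<Longrightarrow> m \<in> N"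
  shows "standard_graded_artinian I"
proof -
  have "f = 0" if "d \<le> 1" "f \<in> I \<inter> forms d" for d f
  proof -
    have "m \<in> N" if "m \<in> Poly_Mapping.keys f" for m
      using assms [of m] \<open>d \<le> 1\<close> \<open>f \<in> I \<inter> forms d\<close> that by (simp add: forms_def)
    then have "Poly_Mapping.keys f = {}"
      using \<open>f \<in> I \<inter> forms d\<close> unfolding I_def by blast
    then show ?thesis
      by simp
  qed
  then show ?thesis
    using homogeneous_ideal finite_dimension_quot_alg by (auto simp: standard_graded_artinian_def)
qed

text \<open>A socle element is killed by every variable. If \<open>m\<close> times the variable
  \<open>v\<close> stays in \<open>N\<close>, the coefficient at \<open>m\<close> reappears in the
  product with \<open>var v\<close>, so it must be 0. The choice of \<open>v\<close> may depend on
  \<open>m\<close>.\<close>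

lemma socle_Int_graded_part:
  assumes "\<And>m. m \<in> N \<Longrightarrow> mon_degree m = i \<Longrightarrow> \<exists>v. m + Poly_Mapping.single v 1 \<in> N"
  shows "socle I \<inter> graded_part I i = {\<zero>\<^bsub>quot_alg I\<^esub>}"
proof (intro equalityI subsetI)
  have vars: "residue_class I ` range var \<subseteq> carrier (quot_alg I)"
    by (auto simp: carrier_quot_alg)
  fix a assume a: "a \<in> socle I \<inter> graded_part I i"
  then obtain f where f: "a = residue_class I f" "f \<in> forms i"
    by (auto simp: graded_part_def)
  have "Poly_Mapping.lookup f m = 0" if "m \<in> N" for m
  proof (rule ccontr)
    assume nz: "Poly_Mapping.lookup f m \<noteq> 0"
    then have "mon_degree m = i"
      using f(2) by (auto simp: forms_def in_keys_iff)
    with \<open>m \<in> N\<close> obtain v where v: "m + Poly_Mapping.single v 1 \<in> N"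
      using assms [of m] by blast
    have "residue_class I (var v) \<in> max_ideal I"
      using Q.genideal_self [OF vars] unfolding max_ideal_def by blast
    then have "residue_class I f \<otimes>\<^bsub>quot_alg I\<^esub> residue_class I (var v) = \<zero>\<^bsub>quot_alg I\<^esub>"
      using a f(1) unfolding socle_def by blast
    then have "residue_class I (f * var v) = \<zero>\<^bsub>quot_alg I\<^esub>"
      using H.hom_mult [of f "var v"] by simp
    then have "f * var v \<in> I"
      by (simp only: residue_class_eq_zero_iff)
    then have "Poly_Mapping.lookup (f * var v) (m + Poly_Mapping.single v 1) = 0"
      using v unfolding in_I_iff by blast
    then show False
      using nz unfolding var_def lookup_mult_single_add by contradiction
  qed
  then show "a \<in> {\<zero>\<^bsub>quot_alg I\<^esub>}"
    by (simp add: f(1) residue_class_eq_zero_iff in_I_iff)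
next
  fix a assume a: "a \<in> {\<zero>\<^bsub>quot_alg I\<^esub>}"
  \<comment> \<open>Zero annihilates \<open>max_ideal I\<close> because that ideal lies in the
    carrier.\<close>
  have "ideal (max_ideal I) (quot_alg I)"
    unfolding max_ideal_def by (rule Q.genideal_ideal) (auto simp: carrier_quot_alg)
  then have "m \<in> carrier (quot_alg I)" if "m \<in> max_ideal I" for m
    using that by (rule ideal.Icarr)
  then have "a \<in> socle I"
    using a by (simp add: socle_def)
  have "a \<in> graded_part I i"
    unfolding graded_part_def
  proof (rule image_eqI)
    show "a = residue_class I 0"
      using a H.hom_zero by simp
    show "0 \<in> forms i"
      by (simp add: forms_def)
  qed
  with \<open>a \<in> socle I\<close> show "a \<in> socle I \<inter> graded_part I i"
    by (rule IntI)
qed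

end

section \<open>The example\<close>

text \<open>The variables 0, 1, 2 are x, y, z. Either x^3 does not divide \<open>m\<close>, or
  \<open>m\<close> is x^3 times a monomial with all exponents at most 3; hence the bound 6 on the
  exponent of x.\<close>

definition standard_monomials :: "(3 \<Rightarrow>\<^sub>0 nat) set" where
  "standard_monomials = {m. mon_degree m \<le> 12 \<and>
     (Poly_Mapping.lookup m 0 \<le> 2 \<or>
      Poly_Mapping.lookup m 0 \<le> 6 \<and> Poly_Mapping.lookup m 1 \<le> 3 \<and> Poly_Mapping.lookup m 2 \<le> 3)}"

section \<open>Exponent triples and the count of standard monomials\<close>

lemma UNIV_3_eq: "(UNIV :: 3 set) = {0, 1, 2}"
  by (rule card_subset_eq [symmetric]) simp_all

lemma mon_degree_3:
  "mon_degree m = Poly_Mapping.lookup m (0 :: 3) + Poly_Mapping.lookup m 1 + Poly_Mapping.lookup m 2"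
  unfolding mon_degree_def UNIV_3_eq by (simp add: add.assoc)

definition mon3 :: "nat \<Rightarrow> nat \<Rightarrow> nat \<Rightarrow> (3 \<Rightarrow>\<^sub>0 nat)" where
  "mon3 a b c = Poly_Mapping.single 0 a + Poly_Mapping.single 1 b + Poly_Mapping.single 2 c"

lemma lookup_mon3 [simp]:
  "Poly_Mapping.lookup (mon3 a b c) 0 = a"
  "Poly_Mapping.lookup (mon3 a b c) 1 = b"
  "Poly_Mapping.lookup (mon3 a b c) 2 = c"
  by (simp_all add: mon3_def lookup_add lookup_single)

lemma mon3_lookup:
  "mon3 (Poly_Mapping.lookup m 0) (Poly_Mapping.lookup m 1) (Poly_Mapping.lookup m 2) = m"
proof (rule poly_mapping_eqI)
  fix k :: 3
  have "k \<in> {0, 1, 2}"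
    using UNIV_3_eq by blast
  then show "Poly_Mapping.lookup (mon3 (Poly_Mapping.lookup m 0) (Poly_Mapping.lookup m 1)
      (Poly_Mapping.lookup m 2)) k = Poly_Mapping.lookup m k"
    by auto
qed

lemma finite_standard_monomials: "finite standard_monomials"
proof (rule finite_subset)
  show "standard_monomials \<subseteq> (\<lambda>(a, b, c). mon3 a b c) ` ({..12} \<times> {..12} \<times> {..12})"
  proof
    fix m assume "m \<in> standard_monomials"
    then have "(Poly_Mapping.lookup m 0, Poly_Mapping.lookup m 1, Poly_Mapping.lookup m 2)
        \<in> {..12} \<times> {..12} \<times> {..12}"
      by (auto simp: standard_monomials_def mon_degree_3)
    then show "m \<in> (\<lambda>(a, b, c). mon3 a b c) ` ({..12} \<times> {..12} \<times> {..12})"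
      by (rule rev_image_eqI) (simp add: mon3_lookup)
  qed
qed simp

text \<open>In degree \<open>i\<close> the third exponent is \<open>i - a - b\<close>, so pairs
  suffice and the count becomes executable. The bound 3 on that exponent reads
  \<open>i \<le> 3 + a + b\<close>, without truncated subtraction; \<open>i \<le> 12\<close>
  disposes of the degree bound.\<close>

lemma card_standard_monomials:
  assumes "i \<le> 12"
  shows "card {m \<in> standard_monomials. mon_degree m = i} =
    length (filter (\<lambda>(a, b). a + b \<le> i \<and> (a \<le> 2 \<or> a \<le> 6 \<and> b \<le> 3 \<and> i \<le> 3 + a + b))
      (List.product [0..<Suc i] [0..<Suc i]))" (is "_ = length ?L")
proof -
  have "{m \<in> standard_monomials. mon_degree m = i} = (\<lambda>(a, b). mon3 a b (i - a - b)) ` set ?L"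
  proof (intro equalityI subsetI)
    fix m assume m: "m \<in> {m \<in> standard_monomials. mon_degree m = i}"
    then have "(Poly_Mapping.lookup m 0, Poly_Mapping.lookup m 1) \<in> set ?L"
      by (auto simp: standard_monomials_def mon_degree_3)
    moreover have "i - Poly_Mapping.lookup m 0 - Poly_Mapping.lookup m 1 = Poly_Mapping.lookup m 2"
      using m by (auto simp: mon_degree_3)
    then have "m = mon3 (Poly_Mapping.lookup m 0) (Poly_Mapping.lookup m 1)
        (i - Poly_Mapping.lookup m 0 - Poly_Mapping.lookup m 1)"
      by (simp add: mon3_lookup)
    ultimately show "m \<in> (\<lambda>(a, b). mon3 a b (i - a - b)) ` set ?L"
      by (metis (no_types, lifting) case_prod_conv image_eqI)
  qed (use assms in \<open>auto simp: standard_monomials_def mon_degree_3\<close>)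
  moreover have "inj_on (\<lambda>(a, b). mon3 a b (i - a - b)) (set ?L)"
    \<comment> \<open>The pair is recovered from the exponents of the first two variables.\<close>
    by (rule inj_onI) (metis (no_types, lifting) case_prod_beta lookup_mon3(1,2) prod_eqI)
  moreover have "distinct ?L"
    by (simp add: distinct_product)
  ultimately show ?thesis
    by (simp only: card_image distinct_card)
qed

lemma card_standard_monomials_values:
  "card {m \<in> standard_monomials. mon_degree m = 1} = 3"
  "card {m \<in> standard_monomials. mon_degree m = 9} = 37"
  "card {m \<in> standard_monomials. mon_degree m = 10} = 36"
  "card {m \<in> standard_monomials. mon_degree m = 11} = 36"
  "card {m \<in> standard_monomials. mon_degree m = 12} = 37"
  by (subst card_standard_monomials, simp, code_simp)+

text \<open>This is the combinatorial content of levelness: below degree 12 some variable can always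
  be multiplied on.\<close>

lemma ex_var_mult_standard_monomial:
  assumes "m \<in> standard_monomials" "mon_degree m < 12"
  shows "\<exists>v. m + Poly_Mapping.single v 1 \<in> standard_monomials"
proof (cases "Poly_Mapping.lookup m 0 \<le> 2 \<or> Poly_Mapping.lookup m 1 < 3")
  case True
  \<comment> \<open>The exponent of y is unrestricted while that of x is at most 2, and otherwise
    has room below 3.\<close>
  then have "m + Poly_Mapping.single 1 1 \<in> standard_monomials"
    using assms by (auto simp: standard_monomials_def mon_degree_3 lookup_add lookup_single)
  then show ?thesis ..
next
  case False
  \<comment> \<open>Now y has exponent 3. If z does too, degree below 12 leaves x an exponent of at
    most 5; the corner x^6 y^3 z^3 has degree exactly 12.\<close>
  then have "m + Poly_Mapping.single (if Poly_Mapping.lookup m 2 < 3 then 2 else 0) 1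
      \<in> standard_monomials"
    using assms by (auto simp: standard_monomials_def mon_degree_3 lookup_add lookup_single)
  then show ?thesis ..
qed

theorem theorem3:
  shows "\<exists>I :: (3, 'k::field_char_0) mpoly set.
           level I \<and> codimension I = 3 \<and> \<not> unimodal (h_vector I)"
proof -
  define I :: "(3, 'k) mpoly set" where "I = {f. Poly_Mapping.keys f \<inter> standard_monomials = {}}"
  interpret monomial_quotient standard_monomials I
  proof
    show "finite standard_monomials"
      by (rule finite_standard_monomials)
    show "m \<in> standard_monomials" if "m + n \<in> standard_monomials" for m n
      using that by (auto simp: standard_monomials_def mon_degree_3 lookup_add)
  qed (simp_all add: I_def standard_monomials_def mon_degree_3)
  have hilbert: "hilbert I 1 = 3" "hilbert I 9 = 37" "hilbert I 10 = 36" "hilbert I 11 = 36"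
    "hilbert I 12 = 37"
    by (simp_all only: hilbert_eq card_standard_monomials_values)
  have socle_degree: "socle_degree I = 12"
    unfolding socle_degree_def
  proof (rule Greatest_equality)
    show "i \<le> 12" if "hilbert I i > 0" for i
      using that by (auto simp: hilbert_eq card_gt_0_iff standard_monomials_def)
    show "hilbert I 12 > 0"
      by (simp only: hilbert)
  qed
  have "level I"
    unfolding level_def socle_degree
  proof (intro conjI allI impI)
    show "standard_graded_artinian I"
      by (rule standard_graded_artinian) (auto simp: standard_monomials_def mon_degree_3)
    show "socle I \<inter> graded_part I i = {\<zero>\<^bsub>quot_alg I\<^esub>}" if "i < 12" for i
      using that ex_var_mult_standard_monomial by (intro socle_Int_graded_part) auto
  qed
  moreover have "codimension I = 3"
    by (simp only: codimension_def hilbert)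
  moreover have "\<not> unimodal (h_vector I)"
  proof -
    have "h_vector I ! i = hilbert I i" if "i \<le> 12" for i
      using that by (simp add: h_vector_def socle_degree nth_append del: upt_Suc)
    then have "h_vector I ! 9 > h_vector I ! 10" "h_vector I ! 11 < h_vector I ! 12"
      by (simp_all add: hilbert)
    moreover have "length (h_vector I) = 13"
      by (simp add: h_vector_def socle_degree)
    \<comment> \<open>The descent is at index 9 and the ascent at 11, with the plateau 36, 36
      between them; the ascent ends at the last entry.\<close>
    ultimately have "9 < (11::nat) \<and> Suc 11 < length (h_vector I) \<and>
        h_vector I ! 9 > h_vector I ! Suc 9 \<and> h_vector I ! 11 < h_vector I ! Suc 11"
      by simp
    then show ?thesis
      unfolding unimodal_def by blast
  qed
  ultimately show ?thesis
    by blast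
qed

end
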